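(* $\displaystyle\lim_{H\to\infty}\frac{I^*_2(H)}{H^2}=4$, $\displaystyle\lim_{H\to\infty}\frac{R^*_2(H)}{H\log H}=\frac{2}{\zeta(2)}=\frac{12}{\pi^2}$, and consequently $\displaystyle\lim_{H\to\infty}\frac{D^*_2(H)}{H^2}=4$.
   Context: A polynomial $f\in\mathbb{C}[X]$ is degenerate if it has two distinct roots whose quotient is a root of unity. $S^*_2(H)$ is the set of polynomials $a_0X^2+a_1X+a_2\in\mathbb{Z}[X]$ with $a_0\ne 0$, degenerate, and $|a_0|,|a_1|,|a_2|\le H$; $D^*_2(H)=|S^*_2(H)|$; $I^*_2(H)$ and $R^*_2(H)$ are the numbers of polynomials in $S^*_2(H)$ that are irreducible, respectively reducible, in $\mathbb{Q}[X]$. $\zeta$ is the Riemann zeta function; $H$ runs over positive integers. *)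

theory Defs
  imports "HOL-Analysis.Analysis" "HOL-Computational_Algebra.Computational_Algebra"
begin

definition root_of_unity :: "complex \<Rightarrow> bool" where
  "root_of_unity z \<longleftrightarrow> (\<exists>n::nat. n > 0 \<and> z ^ n = 1)"

text \<open>A pair of roots containing \<open>0\<close> never witnesses degeneracy: the quotient is \<open>0\<close>
  (by the convention \<open>x / 0 = 0\<close> if the divisor is \<open>0\<close>), which is not a root of unity.\<close>

definition degenerate :: "complex poly \<Rightarrow> bool" where
  "degenerate f \<longleftrightarrow>
     (\<exists>x y. x \<noteq> y \<and> poly f x = 0 \<and> poly f y = 0 \<and> root_of_unity (x / y))"

text \<open>Coefficient lists of polynomials start with the constant term, so \<open>[:a2, a1, a0:]\<close> is
  \<open>a0 X^2 + a1 X + a2\<close>.\<close>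

definition S2 :: "nat \<Rightarrow> int poly set" where
  "S2 H = {f. \<exists>a0 a1 a2. f = [:a2, a1, a0:] \<and> a0 \<noteq> 0 \<and>
                \<bar>a0\<bar> \<le> int H \<and> \<bar>a1\<bar> \<le> int H \<and> \<bar>a2\<bar> \<le> int H \<and>
                degenerate (map_poly of_int f)}"

definition D2 :: "nat \<Rightarrow> nat" where
  "D2 H = card (S2 H)"

definition I2 :: "nat \<Rightarrow> nat" where
  "I2 H = card {f \<in> S2 H. irreducible (map_poly of_int f :: rat poly)}"

text \<open>All members of \<^const>\<open>S2\<close> have degree 2, hence are neither zero nor units in \<open>\<rat>[X]\<close>, so
  being reducible is the same as not being irreducible.\<close>

definition R2 :: "nat \<Rightarrow> nat" where
  "R2 H = card {f \<in> S2 H. \<not> irreducible (map_poly of_int f :: rat poly)}"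

text \<open>The Riemann zeta function on the real half-line \<open>s > 1\<close>, where it is given by its Dirichlet
  series; its value for other arguments is meaningless here.\<close>

definition zeta :: "real \<Rightarrow> real" where
  "zeta s = (\<Sum>n. 1 / real (Suc n) powr s)"

end

theory Submission
  imports Defs "HOL-Number_Theory.Totient" "HOL-Real_Asymp.Real_Asymp"
    "HOL-Library.Discrete_Functions"
begin

text \<open>If \<open>z \<noteq> 1\<close> is the quotient of the roots of \<open>a0 X^2 + a1 X + a2\<close>, then
  \<open>z + 1/z + 2 = a1^2 / (a0 a2)\<close>. For a root of unity \<open>z\<close> this is a rational algebraic integer, hence
  an integer \<open>k\<close>, and \<open>k \<in> {0, 1, 2, 3}\<close> by size. The case \<open>k = 0\<close>, that is \<open>a1 = 0\<close>, yields all
  \<open>4 H^2\<close> polynomials \<open>a0 X^2 + a2\<close> with nonzero coefficients; such a polynomial is reducible iff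
  \<open>- a0 a2\<close> is a square. For \<open>k > 0\<close> the discriminant \<open>(k - 4) a0 a2\<close> is negative, so the polynomial is
  irreducible, and \<open>k a0 a2\<close> is a square. Both \<open>R2 H\<close> and the contribution of \<open>k > 0\<close> are thus governed
  by the number of pairs in \<open>{1..H}\<^sup>2\<close> with square product, which is
  \<open>2 (\<Sum>n. \<phi>(n) \<lfloor>H / n^2\<rfloor>) - H\<close>; its asymptotics follow from those of \<open>\<Sum>n \<le> x. \<phi>(n) / n^2\<close>.\<close>


subsection \<open>The sum of phi(d) / d^2\<close>

definition totient_sum :: "nat \<Rightarrow> real" where
  "totient_sum n = (\<Sum>d=1..n. real (totient d) / real d ^ 2)"

text \<open>Gauss's identity writes \<open>k\<close> as the sum of \<open>totient d\<close> over its
  divisors \<open>d\<close>, so \<open>1 / k\<close> is the divisor sum of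
  \<open>totient d / k^2\<close>; then \<open>k = m d\<close> and the terms are grouped by the
  cofactor \<open>m\<close>.\<close>

lemma harm_eq_totient_sum:
  "harm n = (\<Sum>m=1..n. totient_sum (n div m) / real m ^ 2)"
proof -
  have "(harm n :: real) = (\<Sum>k=1..n. real (\<Sum>d | d dvd k. totient d) / real k ^ 2)"
    unfolding harm_def totient_divisor_sum
    by (intro sum.cong) (auto simp: power2_eq_square field_simps)
  also have "\<dots> = (\<Sum>k=1..n. \<Sum>d | d dvd k. real (totient d) / real k ^ 2)"
    by (simp add: sum_divide_distrib)
  also have "\<dots> = (\<Sum>(k, d)\<in>(SIGMA k:{1..n}. {d. d dvd k}). real (totient d) / real k ^ 2)"
    by (rule sum.Sigma) auto
  also have "\<dots> = (\<Sum>(m, d)\<in>(SIGMA m:{1..n}. {1..n div m}). real (totient d) / real d ^ 2 / real m ^ 2)"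
  proof -
    have *: "d > 0" "k div d > 0" "k div d * d = k" if "k > 0" "d dvd k" for k d :: nat
      using that by (auto intro: Nat.gr0I)
    \<comment> \<open>For fixed \<open>m\<close>, the range \<open>m * d \<le> n\<close> of the old
      index becomes \<open>d \<le> n div m\<close>.\<close>
    have **: "m * d > 0 \<and> m * d \<le> n \<longleftrightarrow> m > 0 \<and> m \<le> n \<and> d > 0 \<and> d \<le> n div m" for m d
      by (cases "m = 0 \<or> d = 0")
        (auto simp: less_eq_div_iff_mult_less_eq mult.commute intro: order.trans[of m "m * d"])
    have ***: "real d ^ 2 * real (k div d) ^ 2 = real k ^ 2" if "k > 0" "d dvd k" for k d
      using *(3)[OF that] by (metis mult.commute of_nat_mult power_mult_distrib)
    show ?thesis
    proof (rule sum.reindex_bij_witness[where i = "\<lambda>(m, d). (m * d, d)" and j = "\<lambda>(k, d). (k div d, d)"], goal_cases)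
      case (1 p)
      then show ?case by auto
    next
      case (2 p)
      then show ?case using *[of "fst p" "snd p"] **[of "fst p div snd p" "snd p"]
        by (auto simp: Suc_le_eq)
    next
      case (3 p)
      then show ?case by auto
    next
      case (4 p)
      then show ?case using **[of "fst p" "snd p"] by (auto simp: Suc_le_eq)
    next
      case (5 p)
      then show ?case using ***[of "fst p" "snd p"] by auto
    qed
  qed
  also have "\<dots> = (\<Sum>m=1..n. \<Sum>d=1..n div m. real (totient d) / real d ^ 2 / real m ^ 2)"
    by (rule sum.Sigma[symmetric]) auto
  also have "\<dots> = (\<Sum>m=1..n. totient_sum (n div m) / real m ^ 2)"
    by (simp add: totient_sum_def sum_divide_distrib)
  finally show ?thesis .
qed

lemma totient_sum_mono: "m \<le> n \<Longrightarrow> totient_sum m \<le> totient_sum n"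
  unfolding totient_sum_def by (rule sum_mono2) auto

text \<open>Because \<open>totient d \<le> d\<close>, each term \<open>totient d / d^2\<close> is at
  most \<open>1 / d\<close>, so \<open>harm k - totient_sum k\<close> never decreases.\<close>

lemma totient_sum_diff_le:
  assumes "m \<le> n"
  shows "totient_sum n - totient_sum m \<le> harm n - harm m"
proof -
  have eq: "harm k - totient_sum k = (\<Sum>d=1..k. 1 / real d - real (totient d) / real d ^ 2)" for k
    by (simp add: harm_def totient_sum_def sum_subtractf inverse_eq_divide)
  have "harm m - totient_sum m \<le> harm n - totient_sum n"
    unfolding eq
  proof (rule sum_mono2)
    fix d assume "d \<in> {1..n} - {1..m}"
    then have "d > 0" by auto
    moreover have "real (totient d) \<le> real d" by (simp add: totient_le)
    ultimately show "0 \<le> 1 / real d - real (totient d) / real d ^ 2"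
      by (simp add: field_simps power2_eq_square)
  qed (use assms in auto)
  then show ?thesis by simp
qed

text \<open>The difference \<open>harm n - ln n\<close> is decreasing and equals 1 at
  \<open>n = 1\<close>.\<close>

lemma harm_le_ln:
  assumes "n > 0"
  shows "harm n \<le> 1 + ln (real n)"
proof -
  obtain k where n: "n = Suc k" using assms gr0_implies_Suc by blast
  have "harm (Suc k) - ln (real (Suc k)) \<le> harm (Suc 0) - ln (real (Suc 0))"
    using decseq_harm_diff_ln unfolding decseq_def by (metis le0)
  then show ?thesis by (simp add: n harm_expand)
qed

text \<open>With \<open>q = n div m\<close>, the increment is at most
  \<open>harm n - harm q \<le> 1 + ln n - ln (q + 1)\<close>, and
  \<open>n < m (q + 1)\<close>.\<close>

lemma totient_sum_diff_div_le:
  assumes "m \<in> {1..n}"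
  shows "totient_sum n - totient_sum (n div m) \<le> 1 + ln (real m)"
proof -
  have m: "m > 0" "n > 0" using assms by auto
  have "n < m * Suc (n div m)"
    using m dividend_less_times_div by simp
  then have "real n \<le> real m * (real (n div m) + 1)"
    by (metis of_nat_Suc of_nat_le_iff of_nat_mult less_imp_le add.commute)
  then have "ln (real n) \<le> ln (real m * (real (n div m) + 1))"
    using m by (subst ln_le_cancel_iff) (auto intro!: mult_pos_pos)
  also have "\<dots> = ln (real m) + ln (real (n div m) + 1)"
    using m by (subst ln_mult) auto
  finally show ?thesis
    using totient_sum_diff_le[of "n div m" n] harm_le_ln[OF m(2)] ln_le_harm[of "n div m"]
    by simp
qed

lemma summable_ln_div_square: "summable (\<lambda>n. (1 + ln (real n)) / real n ^ 2)"
proof (rule summable_comparison_test_bigo)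
  \<comment> \<open>Any exponent strictly between -2 and -1 would do: the power absorbs the
    logarithm and stays summable.\<close>
  show "summable (\<lambda>n. norm (real n powr (-3/2)))"
    by (simp add: summable_real_powr_iff)
  show "(\<lambda>n. (1 + ln (real n)) / real n ^ 2) \<in> O(\<lambda>n. real n powr (-3/2))"
    by real_asymp
qed

text \<open>The extra term at index 0 is \<open>1 / 0 = 0\<close>.\<close>

lemma inverse_squares_sums_from_0: "(\<lambda>n. 1 / real n ^ 2) sums (pi\<^sup>2 / 6)"
  using inverse_squares_sums sums_Suc_iff[of "\<lambda>n. 1 / real n ^ 2" "pi\<^sup>2 / 6"]
  by (simp add: add.commute)

lemma sum_le_suminf_atLeast1:
  fixes f :: "nat \<Rightarrow> real"
  assumes "summable f" "\<And>n. n > 0 \<Longrightarrow> f n \<ge> 0" "f 0 = 0"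
  shows "(\<Sum>m=1..n. f m) \<le> suminf f"
  by (rule sum_le_suminf) (use assms in \<open>auto simp: Suc_le_eq intro: le_neq_implies_less\<close>)

text \<open>Replacing \<open>totient_sum (n div m)\<close> by \<open>totient_sum n\<close> in the identity for \<open>harm n\<close> costs only \<open>O(1)\<close>,
  because \<open>(1 + ln m) / m^2\<close> is summable. This takes the place of Moebius inversion.\<close>

lemma totient_sum_asymp: "(\<lambda>n. totient_sum n / ln (real n)) \<longlonglongrightarrow> 6 / pi\<^sup>2"
proof -
  define Z where "Z n = (\<Sum>m=1..n. 1 / real m ^ 2)" for n
  define C where "C = (\<Sum>m. (1 + ln (real m)) / real m ^ 2)"
  have Z: "Z \<longlonglongrightarrow> pi\<^sup>2 / 6"
  proof -
    have "(\<lambda>n. \<Sum>m\<le>n. 1 / real m ^ 2) \<longlonglongrightarrow> pi\<^sup>2 / 6"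
      using inverse_squares_sums_from_0 by (simp add: sums_def_le)
    moreover have "(\<Sum>m\<le>n. 1 / real m ^ 2) = Z n" for n
      unfolding Z_def by (rule sum.mono_neutral_right) (auto simp: not_less_eq_eq)
    ultimately show ?thesis by simp
  qed
  have diff: "totient_sum n * Z n - harm n =
      (\<Sum>m=1..n. (totient_sum n - totient_sum (n div m)) / real m ^ 2)" for n
    by (simp add: harm_eq_totient_sum Z_def sum_subtractf sum_distrib_left diff_divide_distrib)
  have lower: "0 \<le> totient_sum n * Z n - harm n" for n
    unfolding diff by (intro sum_nonneg divide_nonneg_nonneg) (auto intro: totient_sum_mono)
  have upper: "totient_sum n * Z n - harm n \<le> C" for n
  proof -
    have "totient_sum n * Z n - harm n \<le> (\<Sum>m=1..n. (1 + ln (real m)) / real m ^ 2)"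
      unfolding diff by (intro sum_mono divide_right_mono totient_sum_diff_div_le) auto
    also have "\<dots> \<le> C"
      unfolding C_def by (rule sum_le_suminf_atLeast1[OF summable_ln_div_square]) auto
    finally show ?thesis .
  qed
  \<comment> \<open>The bounds \<open>lower\<close> and \<open>upper\<close>, with the estimates of
    \<open>harm\<close> by logarithms, place \<open>totient_sum n * Z n\<close> between
    \<open>ln (n + 1)\<close> and \<open>1 + ln n + C\<close>.\<close>
  have "(\<lambda>n. totient_sum n * Z n / ln (real n)) \<longlonglongrightarrow> 1"
  proof (rule tendsto_sandwich)
    show "\<forall>\<^sub>F n in sequentially. ln (real n + 1) / ln (real n) \<le> totient_sum n * Z n / ln (real n)"
      using eventually_gt_at_top[of 1]
    proof eventually_elim
      case (elim n)
      then show ?case using lower[of n] ln_le_harm[of n] by (intro divide_right_mono) auto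
    qed
    show "\<forall>\<^sub>F n in sequentially. totient_sum n * Z n / ln (real n) \<le> (1 + ln (real n) + C) / ln (real n)"
      using eventually_gt_at_top[of 1]
    proof eventually_elim
      case (elim n)
      then show ?case using upper[of n] harm_le_ln[of n] by (intro divide_right_mono) auto
    qed
  qed real_asymp+
  \<comment> \<open>Dividing by \<open>Z n\<close>, which tends to \<open>pi\<^sup>2 / 6\<close> and
    is eventually positive, turns the limit 1 into \<open>6 / pi\<^sup>2\<close>.\<close>
  then have "(\<lambda>n. totient_sum n * Z n / ln (real n) / Z n) \<longlonglongrightarrow> 1 / (pi\<^sup>2 / 6)"
    using Z by (intro tendsto_divide) auto
  moreover have "\<forall>\<^sub>F n in sequentially. Z n > 0"
    using order_tendstoD(1)[OF Z, of 0] by simp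
  then have "\<forall>\<^sub>F n in sequentially. totient_sum n * Z n / ln (real n) / Z n = totient_sum n / ln (real n)"
    by eventually_elim simp
  ultimately show ?thesis
    by (simp add: tendsto_cong)
qed

subsection \<open>Pairs whose product is a square\<close>

definition square_pairs :: "nat \<Rightarrow> (nat \<times> nat) set" where
  "square_pairs H = {(a, b). a \<in> {1..H} \<and> b \<in> {1..H} \<and> is_square (a * b)}"

lemma finite_square_pairs: "finite (square_pairs H)"
  by (rule finite_subset[of _ "{1..H} \<times> {1..H}"]) (auto simp: square_pairs_def)

text \<open>After division by \<open>g = gcd a b\<close> the cofactors are coprime and their product
  is still a square, so each cofactor is a square.\<close>

lemma is_square_multE:
  fixes a b :: nat
  assumes "a > 0" "b > 0" "is_square (a * b)"
  obtains g m n where "a = g * m\<^sup>2" "b = g * n\<^sup>2" "coprime m n" "g > 0" "m > 0" "n > 0"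
proof -
  define g where "g = gcd a b"
  obtain a' b' where ab: "a = a' * g" "b = b' * g" and cop: "coprime a' b'"
    unfolding g_def using assms gcd_coprime_exists[of a b] by auto
  have pos: "a' > 0" "b' > 0" "g > 0" using ab assms by auto
  have "is_square (g\<^sup>2 * (a' * b'))"
    using assms(3) by (simp add: ab power2_eq_square mult_ac)
  then obtain c where "g\<^sup>2 * (a' * b') = c\<^sup>2" by (auto simp: is_nth_power_def)
  moreover then have "g dvd c" by (metis dvd_triv_left pow_divides_pow_iff pos2)
  ultimately have "is_square (a' * b')"
    using pos(3) by (auto elim!: dvdE simp: power_mult_distrib is_nth_power_def)
  then obtain m n where mn: "a' = m\<^sup>2" "b' = n\<^sup>2"
    using is_nth_power_mult_coprime_natD[OF cop] pos unfolding is_nth_power_def by metis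
  moreover have "coprime m n" using cop mn by simp
  ultimately show ?thesis using that[of g m n] ab pos by (simp add: mult.commute)
qed

text \<open>The pairs are parametrised as \<open>(g m^2, g n^2)\<close> with \<open>m\<close>, \<open>n\<close> coprime.\<close>

lemma card_square_pairs_le:
  "card {(a, b) \<in> square_pairs H. a \<le> b} = (\<Sum>n=1..H. totient n * (H div n\<^sup>2))"
proof -
  \<comment> \<open>The bound on \<open>g\<close> keeps the larger entry
    \<open>g * n\<^sup>2\<close> within \<open>H\<close>. For \<open>n = 1\<close> the only totative
    is 1, which yields the diagonal pairs.\<close>
  let ?T = "SIGMA n:{1..H}. totatives n \<times> {1..H div n\<^sup>2}"
  let ?f = "\<lambda>(n, m, g). (g * m\<^sup>2, g * n\<^sup>2) :: nat \<times> nat"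
  have "inj_on ?f ?T"
  proof (rule inj_onI; clarsimp)
    fix n m g n' m' g' :: nat
    assume *: "m \<in> totatives n" "m' \<in> totatives n'" "Suc 0 \<le> g" "Suc 0 \<le> g'" "Suc 0 \<le> n"
      and eq: "g * m\<^sup>2 = g' * m'\<^sup>2" "g * n\<^sup>2 = g' * n'\<^sup>2"
    \<comment> \<open>Coprimality lets \<open>g\<close> be recovered as the gcd of the pair.\<close>
    have "coprime (m\<^sup>2) (n\<^sup>2)" "coprime (m'\<^sup>2) (n'\<^sup>2)" using * by (auto simp: in_totatives_iff)
    then have "gcd (g * m\<^sup>2) (g * n\<^sup>2) = g" "gcd (g' * m'\<^sup>2) (g' * n'\<^sup>2) = g'"
      by (simp_all add: gcd_mult_distrib_nat[symmetric])
    with eq have "g = g'" by simp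
    with eq * show "n = n' \<and> m = m' \<and> g = g'" by simp
  qed
  moreover have "?f ` ?T = {(a, b) \<in> square_pairs H. a \<le> b}"
  proof (intro equalityI subsetI)
    fix p assume "p \<in> ?f ` ?T"
    then obtain n m g where p: "p = (g * m\<^sup>2, g * n\<^sup>2)"
      and *: "1 \<le> n" "n \<le> H" "m \<in> totatives n" "1 \<le> g" "g \<le> H div n\<^sup>2"
      by auto
    have mn: "m > 0" "m\<^sup>2 \<le> n\<^sup>2" using * by (auto simp: in_totatives_iff)
    have le: "g * n\<^sup>2 \<le> H" using * by (simp add: less_eq_div_iff_mult_less_eq)
    then have "g * m\<^sup>2 \<le> H" using mn(2) by (meson le_trans mult_le_mono2)
    moreover have "is_square (g * m\<^sup>2 * (g * n\<^sup>2))"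
      by (rule is_nth_powerI[of _ "g * m * n"]) (simp add: power2_eq_square)
    ultimately show "p \<in> {(a, b) \<in> square_pairs H. a \<le> b}"
      using le mn * by (auto simp: p square_pairs_def Suc_le_eq)
  next
    fix p assume "p \<in> {(a, b) \<in> square_pairs H. a \<le> b}"
    then obtain a b where p: "p = (a, b)" "a > 0" "b > 0" "b \<le> H" "a \<le> b" "is_square (a * b)"
      by (auto simp: square_pairs_def)
    from is_square_multE[OF p(2,3,6)] obtain g m n
      where *: "a = g * m\<^sup>2" "b = g * n\<^sup>2" "coprime m n" "g > 0" "m > 0" "n > 0" .
    have "m \<le> n" using p(5) * by simp
    moreover have "g \<le> H div n\<^sup>2" using p(4) * by (simp add: less_eq_div_iff_mult_less_eq)
    moreover have "n \<le> H"
    proof -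
      have "n \<le> g * n\<^sup>2" using * by (simp add: power2_eq_square)
      then show ?thesis using p(4) * by simp
    qed
    ultimately show "p \<in> ?f ` ?T"
      using * by (intro image_eqI[of _ _ "(n, m, g)"]) (auto simp: p in_totatives_iff)
  qed
  ultimately have "card {(a, b) \<in> square_pairs H. a \<le> b} = card ?T"
    using card_image[of ?f ?T] by simp
  then show ?thesis by (simp add: card_SigmaI totient_def)
qed

text \<open>Swapping coordinates exchanges the pairs with \<open>a \<le> b\<close> and those with
  \<open>b \<le> a\<close>; the two families share exactly the \<open>H\<close> diagonal
  pairs.\<close>

lemma card_square_pairs: "card (square_pairs H) + H = 2 * (\<Sum>n=1..H. totient n * (H div n\<^sup>2))"
proof -
  let ?A = "{(a, b) \<in> square_pairs H. a \<le> b}" and ?B = "{(a, b) \<in> square_pairs H. b \<le> a}"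
  have fin: "finite ?A" "finite ?B"
    by (rule finite_subset[OF _ finite_square_pairs[of H]]; auto)+
  have swap: "?B = prod.swap ` ?A"
    by (auto simp: square_pairs_def image_iff mult.commute)
  have "card ?B = card ?A"
    unfolding swap by (rule card_image) auto
  moreover have "?A \<inter> ?B = (\<lambda>a. (a, a)) ` {1..H}"
    by (auto simp: square_pairs_def power2_eq_square[symmetric])
  then have "card (?A \<inter> ?B) = H"
    by (simp add: card_image inj_on_def)
  moreover have "?A \<union> ?B = square_pairs H" by auto
  ultimately show ?thesis
    using card_Un_Int[OF fin] by (simp add: card_square_pairs_le)
qed

section \<open>Asymptotic number of pairs with square product\<close>

text \<open>Terms with \<open>n\<^sup>2 > H\<close> vanish. In the others, dropping the floor in
  \<open>H div n\<^sup>2\<close> costs at most \<open>totient n \<le> n\<close>, in total at most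
  the square of \<open>floor_sqrt H\<close>, hence at most \<open>H\<close>. Doubling this error and
  adding the diagonal gives the constant 3.\<close>

lemma card_square_pairs_bound:
  "\<bar>real (card (square_pairs H)) - 2 * real H * totient_sum (floor_sqrt H)\<bar> \<le> 3 * real H"
proof -
  let ?s = "floor_sqrt H"
  have sH: "?s \<le> H" by (rule floor_sqrt_le)
  have sum: "(\<Sum>n=1..H. totient n * (H div n\<^sup>2)) = (\<Sum>n=1..?s. totient n * (H div n\<^sup>2))"
  proof (rule sum.mono_neutral_right)
    show "\<forall>i\<in>{1..H} - {1..?s}. totient i * (H div i\<^sup>2) = 0"
      by (auto simp: le_floor_sqrt_iff not_le)
  qed (use sH in auto)
  have t: "real (totient n * (H div n\<^sup>2)) \<in> {real H * (real (totient n) / real n ^ 2) - real n ..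
      real H * (real (totient n) / real n ^ 2)}" for n
  proof -
    have le: "real (H div n\<^sup>2) \<le> real H / real n ^ 2"
      using of_nat_div_le_of_nat[of H "n\<^sup>2"] by simp
    have ge: "real H / real n ^ 2 - 1 \<le> real (H div n\<^sup>2)"
      proof (cases "n = 0")
      case False
      have "H < n\<^sup>2 * Suc (H div n\<^sup>2)"
        using False dividend_less_times_div[of "n\<^sup>2" H] by simp
      then have "real H \<le> real (n\<^sup>2 * Suc (H div n\<^sup>2))"
        by (simp only: of_nat_le_iff less_imp_le)
      then show ?thesis using False by (simp add: field_simps)
    qed simp
    have "real (totient n) * (real H / real n ^ 2 - 1) \<le> real (totient n) * real (H div n\<^sup>2)"
      by (intro mult_left_mono ge) auto
    moreover have "real (totient n) * real (H div n\<^sup>2) \<le> real (totient n) * (real H / real n ^ 2)"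
      by (intro mult_left_mono le) auto
    moreover have "real (totient n) \<le> real n" by (simp add: totient_le)
    ultimately show ?thesis by (simp add: algebra_simps)
  qed
  define M where "M = real (\<Sum>n=1..H. totient n * (H div n\<^sup>2))"
  have M: "M = (\<Sum>n=1..?s. real (totient n * (H div n\<^sup>2)))"
    unfolding M_def sum of_nat_sum ..
  have up: "M \<le> real H * totient_sum ?s"
    unfolding M totient_sum_def sum_distrib_left by (rule sum_mono) (use t in auto)
  have "(\<Sum>n=1..?s. real n) \<le> (\<Sum>n=1..?s. real ?s)"
    by (rule sum_mono) auto
  also have "\<dots> = real (?s\<^sup>2)" by (simp add: power2_eq_square)
  also have "\<dots> \<le> real H" by (simp only: of_nat_le_iff floor_sqrt_power2_le)
  finally have "real H * totient_sum ?s - real H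
      \<le> (\<Sum>n=1..?s. real H * (real (totient n) / real n ^ 2) - real n)"
    by (simp add: totient_sum_def sum_distrib_left sum_subtractf)
  also have "\<dots> \<le> M"
    unfolding M by (rule sum_mono) (use t in auto)
  finally have lo: "real H * totient_sum ?s - real H \<le> M" .
  have "real (card (square_pairs H)) + real H = 2 * M"
    unfolding M_def using arg_cong[OF card_square_pairs[of H], of real]
    by (simp only: of_nat_add of_nat_mult of_nat_numeral)
  then show ?thesis using up lo by (auto simp: abs_le_iff)
qed

text \<open>Asymptotically \<open>ln (floor_sqrt H)\<close> is half of \<open>ln H\<close>, which
  cancels the factor 2 of the main term; the error \<open>3 H\<close> is negligible against
  \<open>H ln H\<close>.\<close>

lemma card_square_pairs_asymp:
  "(\<lambda>H. real (card (square_pairs H)) / (real H * ln (real H))) \<longlonglongrightarrow> 6 / pi\<^sup>2"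
proof -
  let ?N = "\<lambda>H. real (card (square_pairs H))"
  have sq: "filterlim floor_sqrt at_top sequentially"
    unfolding filterlim_at_top by (auto intro: eventually_sequentiallyI le_floor_sqrtI)
  have main: "(\<lambda>H. totient_sum (floor_sqrt H) / ln (real (floor_sqrt H))) \<longlonglongrightarrow> 6 / pi\<^sup>2"
    using filterlim_compose[OF totient_sum_asymp sq] by simp
  have ratio: "(\<lambda>H. ln (real (floor_sqrt H)) / ln (real H)) \<longlonglongrightarrow> 1 / 2"
  proof (rule tendsto_sandwich)
    show "\<forall>\<^sub>F H in sequentially. ln (sqrt (real H) - 1) / ln (real H) \<le> ln (real (floor_sqrt H)) / ln (real H)"
      using eventually_gt_at_top[of 1]
    proof eventually_elim
      case (elim H)
      have "real H < real ((Suc (floor_sqrt H))\<^sup>2)"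
        by (simp only: of_nat_less_iff Suc_floor_sqrt_power2_gt)
      then have "sqrt (real H) < real (floor_sqrt H) + 1"
        by (intro real_less_lsqrt) (auto simp: add.commute)
      moreover have "sqrt (real H) > 1" using elim by simp
      ultimately have "ln (sqrt (real H) - 1) \<le> ln (real (floor_sqrt H))"
        by (subst ln_le_cancel_iff) auto
      then show ?case using elim by (intro divide_right_mono) auto
    qed
    show "\<forall>\<^sub>F H in sequentially. ln (real (floor_sqrt H)) / ln (real H) \<le> ln (sqrt (real H)) / ln (real H)"
      using eventually_gt_at_top[of 1]
    proof eventually_elim
      case (elim H)
      have "real ((floor_sqrt H)\<^sup>2) \<le> real H"
        by (simp only: of_nat_le_iff floor_sqrt_power2_le)
      then have "real (floor_sqrt H) \<le> sqrt (real H)"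
        by (intro real_le_rsqrt) auto
      moreover have "floor_sqrt H > 0" using elim by simp
      ultimately have "ln (real (floor_sqrt H)) \<le> ln (sqrt (real H))"
        using elim by (subst ln_le_cancel_iff) auto
      then show ?case using elim by (intro divide_right_mono) auto
    qed
  qed real_asymp+
  have "(\<lambda>H. 2 * (totient_sum (floor_sqrt H) / ln (real (floor_sqrt H)) * (ln (real (floor_sqrt H)) / ln (real H))))
      \<longlonglongrightarrow> 2 * (6 / pi\<^sup>2 * (1 / 2))"
    by (intro tendsto_intros main ratio)
  moreover have "\<forall>\<^sub>F H in sequentially.
      2 * (totient_sum (floor_sqrt H) / ln (real (floor_sqrt H)) * (ln (real (floor_sqrt H)) / ln (real H)))
      = 2 * real H * totient_sum (floor_sqrt H) / (real H * ln (real H))"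
    \<comment> \<open>This makes \<open>floor_sqrt H \<ge> 2\<close>, so its logarithm is nonzero
      and cancels.\<close>
    using eventually_gt_at_top[of 4]
  proof eventually_elim
    case (elim H)
    then have "floor_sqrt H \<ge> 2" by (intro le_floor_sqrtI) auto
    then have "ln (real (floor_sqrt H)) > 0" by (intro ln_gt_zero) simp
    then show ?case using elim by (simp add: field_simps)
  qed
  ultimately have lim: "(\<lambda>H. 2 * real H * totient_sum (floor_sqrt H) / (real H * ln (real H))) \<longlonglongrightarrow> 6 / pi\<^sup>2"
    by (simp add: tendsto_cong)
  have "(\<lambda>H. ?N H / (real H * ln (real H)) - 2 * real H * totient_sum (floor_sqrt H) / (real H * ln (real H))) \<longlonglongrightarrow> 0"
  proof (rule Lim_null_comparison)
    show "\<forall>\<^sub>F H in sequentially. norm (?N H / (real H * ln (real H)) -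
        2 * real H * totient_sum (floor_sqrt H) / (real H * ln (real H))) \<le> 3 / ln (real H)"
      using eventually_gt_at_top[of 1]
    proof eventually_elim
      case (elim H)
      then have pos: "real H * ln (real H) > 0" by simp
      have "norm (?N H / (real H * ln (real H)) - 2 * real H * totient_sum (floor_sqrt H) / (real H * ln (real H)))
        = \<bar>?N H - 2 * real H * totient_sum (floor_sqrt H)\<bar> / (real H * ln (real H))"
        using pos by (simp only: diff_divide_distrib[symmetric] real_norm_def abs_divide abs_of_pos)
      also have "\<dots> \<le> 3 * real H / (real H * ln (real H))"
        using pos by (intro divide_right_mono card_square_pairs_bound) auto
      also have "\<dots> = 3 / ln (real H)" using elim by simp
      finally show ?case .
    qed
  qed real_asymp
  from tendsto_add[OF this lim] show ?thesis by simp
qed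

text \<open>The order \<open>H ln H\<close> is below \<open>H^2\<close>. The dilation
  \<open>c\<close> will be 3 for the polynomials with \<open>a1 \<noteq> 0\<close> and 1 for the
  reducible ones.\<close>

lemma card_square_pairs_div_square:
  assumes "c > 0"
  shows "(\<lambda>H. real (card (square_pairs (c * H))) / real H ^ 2) \<longlonglongrightarrow> 0"
proof -
  have c: "real c > 0" using assms by simp
  have "filterlim (\<lambda>H. c * H) at_top sequentially"
    using assms by (simp add: mult_nat_left_at_top)
  from filterlim_compose[OF card_square_pairs_asymp this]
  have "(\<lambda>H. real (card (square_pairs (c * H))) / (real (c * H) * ln (real (c * H)))) \<longlonglongrightarrow> 6 / pi\<^sup>2" .
  moreover have "(\<lambda>H. real (c * H) * ln (real (c * H)) / real H ^ 2) \<longlonglongrightarrow> 0"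
    using c unfolding of_nat_mult by real_asymp
  ultimately have "(\<lambda>H. real (card (square_pairs (c * H))) / (real (c * H) * ln (real (c * H))) *
      (real (c * H) * ln (real (c * H)) / real H ^ 2)) \<longlonglongrightarrow> 6 / pi\<^sup>2 * 0"
    by (rule tendsto_mult)
  moreover have "\<forall>\<^sub>F H in sequentially. real (card (square_pairs (c * H))) / (real (c * H) * ln (real (c * H))) *
      (real (c * H) * ln (real (c * H)) / real H ^ 2) = real (card (square_pairs (c * H))) / real H ^ 2"
    using eventually_gt_at_top[of 1]
  proof eventually_elim
    case (elim H)
    then have "c * H > 1" using assms by (metis One_nat_def less_1_mult mult_1 nat_less_le Suc_leI)
    then have "real (c * H) > 1" using of_nat_less_iff[where 'a = real, of 1 "c * H"] by simp
    then have "real (c * H) \<noteq> 0" "ln (real (c * H)) \<noteq> 0" using ln_gt_zero[of "real (c * H)"] by linarith+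
    then show ?case by (simp del: of_nat_mult of_nat_eq_0_iff)
  qed
  ultimately have "(\<lambda>H. real (card (square_pairs (c * H))) / real H ^ 2) \<longlonglongrightarrow> 6 / pi\<^sup>2 * 0"
    by (rule Lim_transform_eventually)
  then show ?thesis by simp
qed

subsection \<open>Degenerate quadratic polynomials\<close>

text \<open>The Dickson polynomials with parameter 1, that is \<open>2 T_n(x / 2)\<close> for the
  Chebyshev polynomials \<open>T_n\<close>; they express \<open>z^n + 1 / z^n\<close> through
  \<open>z + 1 / z\<close>.\<close>

fun dickson_poly :: "nat \<Rightarrow> complex poly" where
  "dickson_poly 0 = [:2:]"
| "dickson_poly (Suc 0) = [:0, 1:]"
| "dickson_poly (Suc (Suc n)) = pCons 0 (dickson_poly (Suc n)) - dickson_poly n"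

lemma poly_dickson_poly:
  assumes "z \<noteq> 0"
  shows "poly (dickson_poly n) (z + 1 / z) = z ^ n + 1 / z ^ n"
  using assms by (induction n rule: dickson_poly.induct) (simp_all add: field_simps)

lemma coeff_dickson_poly_Ints: "coeff (dickson_poly n) i \<in> \<int>"
  by (induction n arbitrary: i rule: dickson_poly.induct) (auto simp: coeff_pCons split: nat.splits)

lemma coeff_dickson_poly_eq_0: "i > n \<Longrightarrow> coeff (dickson_poly n) i = 0"
  by (induction n arbitrary: i rule: dickson_poly.induct) (auto simp: coeff_pCons split: nat.splits)

lemma coeff_dickson_poly_top: "n > 0 \<Longrightarrow> coeff (dickson_poly n) n = 1"
  by (induction n rule: dickson_poly.induct) (auto simp: coeff_dickson_poly_eq_0)

text \<open>If \<open>z ^ n = 1\<close> with \<open>n > 0\<close>, then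
  \<open>z ^ n + 1 / z ^ n = 2\<close>, so \<open>z + 1 / z\<close> is a root of the monic integer
  polynomial \<open>dickson_poly n - [:2:]\<close>.\<close>

lemma root_of_unity_trace_algebraic_int:
  assumes "root_of_unity z"
  shows "algebraic_int (z + 1 / z)"
proof -
  obtain n where n: "n > 0" "z ^ n = 1" using assms by (auto simp: root_of_unity_def)
  then have z: "z \<noteq> 0" by (auto simp: power_0_left)
  let ?p = "dickson_poly n - [:2:]"
  have top: "coeff ?p n = 1"
    using n coeff_dickson_poly_top[of n] by (simp add: coeff_pCons split: nat.splits)
  moreover have "degree ?p \<le> n"
    using n by (intro degree_le) (auto simp: coeff_dickson_poly_eq_0 coeff_pCons split: nat.splits)
  ultimately have "degree ?p = n"
    by (metis le_antisym le_degree zero_neq_one)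
  with top have "lead_coeff ?p = 1" by simp
  moreover have "\<forall>i. coeff ?p i \<in> \<int>"
    by (auto simp: coeff_dickson_poly_Ints coeff_pCons split: nat.splits)
  moreover have "poly ?p (z + 1 / z) = 0"
    using n z by (simp add: poly_dickson_poly)
  ultimately show ?thesis by (rule algebraic_int.intros)
qed

text \<open>A rational algebraic integer is an integer; \<open>norm z = 1\<close> bounds it by 2 in
  absolute value, and the value 2 would give \<open>(z - 1)\<^sup>2 = 0\<close>.\<close>

lemma root_of_unity_rational_trace:
  assumes "root_of_unity z" "z \<noteq> 1" "z + 1 / z \<in> \<rat>"
  obtains k :: int where "z + 1 / z = of_int k" "k \<in> {-2..1}"
proof -
  obtain k where k: "z + 1 / z = of_int k"
    using rational_algebraic_int_is_int[OF root_of_unity_trace_algebraic_int[OF assms(1)] assms(3)]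
    by (auto elim: Ints_cases)
  obtain n where n: "n > 0" "z ^ n = 1" using assms by (auto simp: root_of_unity_def)
  then have "norm z ^ n = 1 ^ n" by (metis norm_one norm_power power_one)
  then have "norm z = 1" using power_eq_imp_eq_base[of "norm z" n 1] n(1) by simp
  then have "norm (z + 1 / z) \<le> 2" "z \<noteq> 0"
    using norm_triangle_ineq[of z "1 / z"] by (auto simp: norm_divide)
  then have "\<bar>k\<bar> \<le> 2" unfolding k by simp
  moreover have "k \<noteq> 2"
  proof
    assume "k = 2"
    then have "(z - 1)\<^sup>2 = 0" using k \<open>z \<noteq> 0\<close> by (simp add: field_simps power2_eq_square)
    with assms(2) show False by simp
  qed
  ultimately have "k \<in> {-2..1}" unfolding atLeastAtMost_iff by linarith
  with k show ?thesis by (rule that)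
qed

section \<open>Degeneracy in terms of the coefficients\<close>

lemma map_poly_of_int_quadratic:
  "(map_poly of_int [:a2, a1, a0:] :: 'a :: {ring_char_0, comm_ring_1} poly) = [:of_int a2, of_int a1, of_int a0:]"
  by (simp add: map_poly_pCons)

text \<open>The \<open>k\<close> obtained is the trace \<open>z + 1 / z\<close> of the quotient
  \<open>z\<close> of the roots, plus 2, which moves its range to \<open>{0..3}\<close>;
  \<open>a2\<close> is nonzero because neither root is 0.\<close>

lemma degenerate_quadraticD:
  fixes a0 a1 a2 :: int
  assumes a0: "a0 \<noteq> 0" and deg: "degenerate (map_poly of_int [:a2, a1, a0:])"
  obtains k where "k \<in> {0..3}" "a1\<^sup>2 = k * (a0 * a2)" "a2 \<noteq> 0"
proof -
  define A B C :: complex where "A = of_int a0" and "B = of_int a1" and "C = of_int a2"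
  have A: "A \<noteq> 0" using a0 by (simp add: A_def)
  obtain x y where xy: "x \<noteq> y" "root_of_unity (x / y)"
    and x: "C + x * (B + x * A) = 0" and y: "C + y * (B + y * A) = 0"
    using deg unfolding degenerate_def map_poly_of_int_quadratic by (auto simp: A_def B_def C_def)
  have nz: "x \<noteq> 0" "y \<noteq> 0" using xy(2) by (auto simp: root_of_unity_def power_0_left)
  \<comment> \<open>Subtracting the two root equations and cancelling \<open>x - y\<close> yields
    Vieta's formulas.\<close>
  have "(x - y) * (B + A * (x + y)) = 0" using x y by algebra
  then have B: "B = - A * (x + y)" using xy(1) by (simp add: eq_neg_iff_add_eq_0)
  then have C: "C = A * x * y" using x by algebra
  have C0: "C \<noteq> 0" using C A nz by simp
  have "x / y + 1 / (x / y) = (B\<^sup>2 - 2 * A * C) / (A * C)"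
    using nz A unfolding B C by (simp add: field_simps power2_eq_square)
  also have "\<dots> \<in> \<rat>" unfolding A_def B_def C_def by (intro Rats_divide Rats_diff Rats_mult Rats_power) auto
  finally have rat: "x / y + 1 / (x / y) \<in> \<rat>" .
  from xy(1) nz have "x / y \<noteq> 1" by simp
  from root_of_unity_rational_trace[OF xy(2) this rat] obtain k
    where k: "x / y + 1 / (x / y) = of_int k" "k \<in> {-2..1}" .
  then have "x\<^sup>2 + y\<^sup>2 = of_int k * x * y" using nz by (simp add: field_simps power2_eq_square)
  then have "B\<^sup>2 = (of_int k + 2) * (A * C)" unfolding B C by algebra
  then have "(of_int (a1\<^sup>2) :: complex) = of_int ((k + 2) * (a0 * a2))"
    by (simp add: A_def B_def C_def)
  then have "a1\<^sup>2 = (k + 2) * (a0 * a2)" by (simp only: of_int_eq_iff)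
  with k(2) C0 show ?thesis by (intro that[of "k + 2"]) (auto simp: C_def)
qed

text \<open>The roots are \<open>x\<close> and \<open>- x\<close> with \<open>x \<noteq> 0\<close>,
  and their quotient is -1.\<close>

lemma degenerate_pure_quadratic:
  fixes a0 a2 :: int
  assumes "a0 \<noteq> 0" "a2 \<noteq> 0"
  shows "degenerate (map_poly of_int [:a2, 0, a0:])"
proof -
  define x where "x = csqrt (- of_int a2 / of_int a0)"
  have "x\<^sup>2 = - of_int a2 / of_int a0" by (simp add: x_def)
  then have root: "of_int a2 + x * (x * of_int a0) = 0"
    using assms by (simp add: field_simps power2_eq_square)
  have x: "x \<noteq> 0" using assms by (simp add: x_def)
  have "root_of_unity (x / - x)"
    unfolding root_of_unity_def using x by (intro exI[of _ 2]) simp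
  with x root show ?thesis
    unfolding degenerate_def map_poly_of_int_quadratic
    by (intro exI[of _ x] exI[of _ "- x"]) auto
qed

section \<open>Irreducibility of quadratic polynomials\<close>

text \<open>A proper factorisation in degree 2 has linear factors, and a linear polynomial over a
  field has a root.\<close>

lemma irreducible_degree_2_iff:
  fixes p :: "'a :: field poly"
  assumes "degree p = 2"
  shows "irreducible p \<longleftrightarrow> (\<forall>x. poly p x \<noteq> 0)"
proof
  assume "irreducible p"
  then show "\<forall>x. poly p x \<noteq> 0"
    using root_imp_reducible_poly[of p] assms by auto
next
  assume no_root: "\<forall>x. poly p x \<noteq> 0"
  have p0: "p \<noteq> 0" using assms by auto
  show "irreducible p"
  proof (rule irreducibleI)
    show "\<not> p dvd 1" using assms by (auto simp: is_unit_iff_degree[OF p0])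
    fix a b assume ab: "p = a * b"
    then have nz: "a \<noteq> 0" "b \<noteq> 0" using p0 by auto
    have deg: "degree a + degree b = 2" using ab nz assms by (simp add: degree_mult_eq)
    have "degree q \<noteq> 1" if "q dvd p" for q
    proof
      assume "degree q = 1"
      then obtain c d where "q = [:c, d:]" "d \<noteq> 0" by (rule degree1_coeffs)
      then have "poly q (- c / d) = 0" by simp
      with that no_root show False by (auto elim: dvdE)
    qed
    then have "degree a \<noteq> 1" using ab by auto
    with deg have "degree a = 0 \<or> degree b = 0" by linarith
    then show "a dvd 1 \<or> b dvd 1" using nz by (simp add: is_unit_iff_degree)
  qed (fact p0)
qed

text \<open>For a rational root \<open>x\<close>, the number \<open>a0 x\<close> is a rational
  square root of the integer \<open>- (a0 * a2)\<close>, hence an integer; conversely,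
  \<open>c / a0\<close> is a root.\<close>

lemma reducible_pure_quadratic_iff:
  fixes a0 a2 :: int
  assumes "a0 \<noteq> 0"
  shows "\<not> irreducible (map_poly of_int [:a2, 0, a0:] :: rat poly) \<longleftrightarrow> (\<exists>c. c\<^sup>2 = - (a0 * a2))"
proof -
  let ?A = "of_int a0 :: rat" and ?C = "of_int a2 :: rat"
  have "irreducible [:?C, 0, ?A:] \<longleftrightarrow> (\<forall>x. poly [:?C, 0, ?A:] x \<noteq> 0)"
    by (rule irreducible_degree_2_iff) (use assms in simp)
  then have "\<not> irreducible (map_poly of_int [:a2, 0, a0:] :: rat poly) \<longleftrightarrow> (\<exists>x. ?C + x * (x * ?A) = 0)"
    unfolding map_poly_of_int_quadratic by simp
  also have "\<dots> \<longleftrightarrow> (\<exists>c. c\<^sup>2 = - (a0 * a2))"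
  proof
    assume "\<exists>x. ?C + x * (x * ?A) = 0"
    then obtain x where x: "?C + x * (x * ?A) = 0" by blast
    obtain p q where pq: "x = of_int p / of_int q" "q > 0"
      by (cases x rule: Rat_cases) (auto simp: Fract_of_int_quotient)
    have "(of_int ((a0 * p)\<^sup>2) :: rat) = of_int (- (a0 * a2) * q\<^sup>2)"
    proof -
      have "?C * of_int q ^ 2 + of_int p ^ 2 * ?A = 0"
        using x pq by (simp add: field_simps power2_eq_square)
      then show ?thesis by (simp only: of_int_mult of_int_minus of_int_power power_mult_distrib) algebra
    qed
    then have eq: "(a0 * p)\<^sup>2 = - (a0 * a2) * q\<^sup>2" by (simp only: of_int_eq_iff)
    \<comment> \<open>Divisibility between squares descends to their bases, so
      \<open>a0 * p / q\<close> is an integer \<open>c\<close>.\<close>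
    then have "q\<^sup>2 dvd (a0 * p)\<^sup>2" by (metis dvd_triv_right)
    then have "q dvd a0 * p" by simp
    then obtain c where "a0 * p = q * c" ..
    with eq have "(c\<^sup>2 + a0 * a2) * q\<^sup>2 = 0" by algebra
    with pq(2) have "c\<^sup>2 = - (a0 * a2)" by (simp add: eq_neg_iff_add_eq_0)
    then show "\<exists>c. c\<^sup>2 = - (a0 * a2)" ..
  next
    assume "\<exists>c. c\<^sup>2 = - (a0 * a2)"
    then obtain c where "c\<^sup>2 = - (a0 * a2)" ..
    then have "(of_int c :: rat)\<^sup>2 = - (?A * ?C)"
      by (metis of_int_minus of_int_mult of_int_power)
    then have "?C + (of_int c / ?A) * ((of_int c / ?A) * ?A) = 0"
      using assms by (simp add: field_simps power2_eq_square)
    then show "\<exists>x. ?C + x * (x * ?A) = 0" by blast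
  qed
  finally show ?thesis .
qed

text \<open>Completing the square at a rational root would make the negative discriminant a
  square.\<close>

lemma irreducible_quadratic_neg_disc:
  fixes a0 a1 a2 :: int
  assumes "a0 \<noteq> 0" "a1\<^sup>2 < 4 * (a0 * a2)"
  shows "irreducible (map_poly of_int [:a2, a1, a0:] :: rat poly)"
proof -
  let ?A = "of_int a0 :: rat" and ?B = "of_int a1 :: rat" and ?C = "of_int a2 :: rat"
  have "?C + x * (?B + x * ?A) \<noteq> 0" for x
  proof
    assume "?C + x * (?B + x * ?A) = 0"
    then have "(2 * ?A * x + ?B)\<^sup>2 = ?B\<^sup>2 - 4 * (?A * ?C)" by algebra
    also have "\<dots> = of_int (a1\<^sup>2 - 4 * (a0 * a2))" by simp
    also have "\<dots> < 0" using assms(2) by (simp only: of_int_less_0_iff)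
    finally show False by (simp add: not_less)
  qed
  then show ?thesis
    unfolding map_poly_of_int_quadratic using assms(1)
    by (subst irreducible_degree_2_iff) auto
qed

section \<open>Counting by the middle coefficient\<close>

text \<open>These are the members of \<open>S2 H\<close> with middle coefficient 0: for
  \<open>a2 = 0\<close> the only root would be 0, which excludes degeneracy.\<close>

definition pure_quadratics :: "nat \<Rightarrow> int poly set" where
  "pure_quadratics H = {f. \<exists>a0 a2. f = [:a2, 0, a0:] \<and> a0 \<noteq> 0 \<and> a2 \<noteq> 0 \<and> \<bar>a0\<bar> \<le> int H \<and> \<bar>a2\<bar> \<le> int H}"

definition mixed_quadratics :: "nat \<Rightarrow> int poly set" where
  "mixed_quadratics H = {f \<in> S2 H. coeff f 1 \<noteq> 0}"

lemma S2_eq: "S2 H = pure_quadratics H \<union> mixed_quadratics H"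
proof (intro equalityI subsetI)
  fix f assume f: "f \<in> S2 H"
  then obtain a0 a1 a2 where *: "f = [:a2, a1, a0:]" "a0 \<noteq> 0" "\<bar>a0\<bar> \<le> int H" "\<bar>a2\<bar> \<le> int H"
    "degenerate (map_poly of_int [:a2, a1, a0:])" by (auto simp: S2_def)
  with degenerate_quadraticD[OF *(2,5)] have "a2 \<noteq> 0" by metis
  with * f show "f \<in> pure_quadratics H \<union> mixed_quadratics H"
    by (cases "a1 = 0") (auto simp: pure_quadratics_def mixed_quadratics_def)
next
  fix f assume "f \<in> pure_quadratics H \<union> mixed_quadratics H"
  then show "f \<in> S2 H"
    using degenerate_pure_quadratic unfolding S2_def pure_quadratics_def mixed_quadratics_def by fastforce
qed

lemma pure_mixed_disjoint: "pure_quadratics H \<inter> mixed_quadratics H = {}"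
  by (auto simp: pure_quadratics_def mixed_quadratics_def)

lemma pure_quadratics_eq_image:
  "pure_quadratics H = (\<lambda>(a0, a2). [:a2, 0, a0:]) ` (({- int H..int H} - {0}) \<times> ({- int H..int H} - {0}))"
  by (auto simp: pure_quadratics_def image_iff abs_le_iff)

lemma finite_pure_quadratics: "finite (pure_quadratics H)"
  unfolding pure_quadratics_eq_image by auto

lemma card_pure_quadratics: "card (pure_quadratics H) = 4 * H ^ 2"
proof -
  have "card ({- int H..int H} - {0}) = 2 * H"
    by (subst card_Diff_singleton) auto
  then show ?thesis
    unfolding pure_quadratics_eq_image
    by (subst card_image) (auto simp: inj_on_def power2_eq_square)
qed

text \<open>Since \<open>a1 \<noteq> 0\<close>, the square \<open>k * (a0 * a2)\<close> is positive;
  with \<open>k \<ge> 0\<close> this excludes \<open>k = 0\<close> and gives \<open>a0\<close> and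
  \<open>a2\<close> the same sign.\<close>

lemma mixed_quadraticsD:
  assumes "f \<in> mixed_quadratics H"
  obtains a0 a1 a2 k where "f = [:a2, a1, a0:]" "a0 \<noteq> 0" "\<bar>a0\<bar> \<le> int H" "\<bar>a2\<bar> \<le> int H" "a1 \<noteq> 0" "a2 \<noteq> 0"
    "k \<in> {1..3}" "a1\<^sup>2 = k * (a0 * a2)" "a0 * a2 > 0"
proof -
  from assms obtain a0 a1 a2 where *: "f = [:a2, a1, a0:]" "a0 \<noteq> 0" "\<bar>a0\<bar> \<le> int H" "\<bar>a2\<bar> \<le> int H"
    "degenerate (map_poly of_int [:a2, a1, a0:])" "a1 \<noteq> 0"
    by (auto simp: S2_def mixed_quadratics_def)
  from degenerate_quadraticD[OF *(2,5)] obtain k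
    where k: "k \<in> {0..3}" "a1\<^sup>2 = k * (a0 * a2)" "a2 \<noteq> 0" .
  have pos: "k * (a0 * a2) > 0" using *(6) k(2) by (metis zero_less_power2)
  with k(1) have "k \<in> {1..3}" by (cases "k = 0") auto
  moreover from pos k(1) have "a0 * a2 > 0" by (auto simp: zero_less_mult_iff)
  ultimately show ?thesis using that * k by blast
qed

lemma irreducible_mixed_quadratic:
  assumes "f \<in> mixed_quadratics H"
  shows "irreducible (map_poly of_int f :: rat poly)"
proof -
  from assms obtain a0 a1 a2 k where *: "f = [:a2, a1, a0:]" "a0 \<noteq> 0"
    "k \<in> {1..3}" "a1\<^sup>2 = k * (a0 * a2)" "a0 * a2 > 0"
    by (rule mixed_quadraticsD)
  have "k * (a0 * a2) < 4 * (a0 * a2)" using * by (intro mult_strict_right_mono) auto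
  with * show ?thesis by (auto intro: irreducible_quadratic_neg_disc)
qed

text \<open>A polynomial with \<open>a1^2 = k a0 a2\<close> is determined by \<open>k\<close>, three signs and the pair \<open>(k |a0|, |a2|)\<close>, whose
  product is a square.\<close>

lemma mixed_quadratics_bound:
  "finite (mixed_quadratics H)" "card (mixed_quadratics H) \<le> 24 * card (square_pairs (3 * H))"
proof -
  \<comment> \<open>Three values of \<open>k\<close> and eight sign patterns make up the factor 24;
    \<open>k \<le> 3\<close> accounts for \<open>3 * H\<close>.\<close>
  let ?T = "{1..3::nat} \<times> {-1, 1::int} \<times> {-1, 1::int} \<times> {-1, 1::int} \<times> square_pairs (3 * H)"
  let ?g = "\<lambda>(k, s0, s1, s2, (a, b)). [:s2 * int b, s1 * int (floor_sqrt (a * b)), s0 * int (a div k):]"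
  have fin: "finite ?T" by (auto simp: finite_square_pairs)
  have sub: "mixed_quadratics H \<subseteq> ?g ` ?T"
  proof
    fix f assume "f \<in> mixed_quadratics H"
    then obtain a0 a1 a2 k where *: "f = [:a2, a1, a0:]" "a0 \<noteq> 0" "\<bar>a0\<bar> \<le> int H" "\<bar>a2\<bar> \<le> int H"
      "a1 \<noteq> 0" "a2 \<noteq> 0" "k \<in> {1..3}" "a1\<^sup>2 = k * (a0 * a2)" "a0 * a2 > 0"
      by (rule mixed_quadraticsD)
    \<comment> \<open>Absorbing \<open>k\<close> into \<open>a\<close> turns \<open>a * b\<close>
      into the square of \<open>a1\<close>; division by \<open>k\<close> restores
      \<open>|a0|\<close>.\<close>
    define a b where "a = nat k * nat \<bar>a0\<bar>" and "b = nat \<bar>a2\<bar>"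
    have "int (a * b) = k * \<bar>a0 * a2\<bar>" using *(7) by (simp add: a_def b_def abs_mult)
    also have "\<dots> = int ((nat \<bar>a1\<bar>)\<^sup>2)" using *(8,9) by simp
    finally have ab: "a * b = (nat \<bar>a1\<bar>)\<^sup>2" by (simp only: of_nat_eq_iff)
    have "a \<le> 3 * H" unfolding a_def using *(3,7) by (intro mult_mono) auto
    moreover have "is_square (a * b)" unfolding ab by simp
    ultimately have "(a, b) \<in> square_pairs (3 * H)"
      using * by (auto simp: square_pairs_def a_def b_def Suc_le_eq)
    then have "(nat k, sgn a0, sgn a1, sgn a2, (a, b)) \<in> ?T"
      using * by (auto simp: sgn_if)
    moreover have "f = ?g (nat k, sgn a0, sgn a1, sgn a2, (a, b))"
    proof -
      have "sgn a0 * int (a div nat k) = a0" using *(7) by (simp add: a_def sgn_mult_abs)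
      moreover have "sgn a1 * int (floor_sqrt (a * b)) = a1" unfolding ab by (simp add: sgn_mult_abs)
      moreover have "sgn a2 * int b = a2" by (simp add: b_def sgn_mult_abs)
      ultimately show ?thesis using *(1) by simp
    qed
    ultimately show "f \<in> ?g ` ?T" by (intro image_eqI)
  qed
  show "finite (mixed_quadratics H)"
    by (rule finite_subset[OF sub]) (use fin in blast)
  have "card (mixed_quadratics H) \<le> card (?g ` ?T)"
    by (rule card_mono[OF _ sub]) (use fin in blast)
  also have "\<dots> \<le> card ?T" by (rule card_image_le[OF fin])
  also have "\<dots> = 24 * card (square_pairs (3 * H))" by (simp add: card_cartesian_product)
  finally show "card (mixed_quadratics H) \<le> 24 * card (square_pairs (3 * H))" .
qed

lemma finite_S2: "finite (S2 H)"
  by (simp add: S2_eq finite_pure_quadratics mixed_quadratics_bound)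

lemma D2_eq: "D2 H = 4 * H ^ 2 + card (mixed_quadratics H)"
  unfolding D2_def S2_eq
  by (simp add: card_Un_disjoint finite_pure_quadratics mixed_quadratics_bound pure_mixed_disjoint card_pure_quadratics)

lemma I2_add_R2: "I2 H + R2 H = D2 H"
proof -
  let ?I = "{f \<in> S2 H. irreducible (map_poly of_int f :: rat poly)}"
  let ?R = "{f \<in> S2 H. \<not> irreducible (map_poly of_int f :: rat poly)}"
  have "card (?I \<union> ?R) = card ?I + card ?R"
    by (rule card_Un_disjoint) (auto simp: finite_S2)
  moreover have "?I \<union> ?R = S2 H" by auto
  ultimately show ?thesis by (simp add: I2_def R2_def D2_def)
qed

text \<open>Reducibility forces \<open>a1 = 0\<close> and \<open>- (a0 * a2)\<close> to be a square,
  so \<open>a0\<close> and \<open>a2\<close> have opposite signs and \<open>(|a0|, |a2|)\<close> is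
  a square pair. The factor 2 is the choice of the sign of \<open>a2\<close>.\<close>

lemma R2_eq: "R2 H = 2 * card (square_pairs H)"
proof -
  let ?T = "{-1, 1::int} \<times> square_pairs H"
  let ?g = "\<lambda>(s, (a, b)). [:s * int b, 0, - s * int a:]"
  have "{f \<in> S2 H. \<not> irreducible (map_poly of_int f :: rat poly)} =
      {f \<in> pure_quadratics H. \<not> irreducible (map_poly of_int f :: rat poly)}"
    using irreducible_mixed_quadratic by (auto simp: S2_eq)
  also have "\<dots> = ?g ` ?T"
  proof (intro equalityI subsetI)
    fix f assume "f \<in> {f \<in> pure_quadratics H. \<not> irreducible (map_poly of_int f :: rat poly)}"
    then obtain a0 a2 where *: "f = [:a2, 0, a0:]" "a0 \<noteq> 0" "a2 \<noteq> 0" "\<bar>a0\<bar> \<le> int H" "\<bar>a2\<bar> \<le> int H"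
      and "\<not> irreducible (map_poly of_int [:a2, 0, a0:] :: rat poly)"
      by (auto simp: pure_quadratics_def)
    then obtain c where c: "c\<^sup>2 = - (a0 * a2)" using reducible_pure_quadratic_iff by blast
    have "a0 * a2 \<noteq> 0" using *(2,3) by simp
    moreover have "a0 * a2 \<le> 0" using c zero_le_power2[of c] by linarith
    ultimately have neg: "a0 * a2 < 0" by linarith
    have "int (nat \<bar>a0\<bar> * nat \<bar>a2\<bar>) = int ((nat \<bar>c\<bar>)\<^sup>2)"
      using c neg by (simp add: abs_mult[symmetric])
    then have "nat \<bar>a0\<bar> * nat \<bar>a2\<bar> = (nat \<bar>c\<bar>)\<^sup>2" by (simp only: of_nat_eq_iff)
    then have "(nat \<bar>a0\<bar>, nat \<bar>a2\<bar>) \<in> square_pairs H"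
      using * by (auto simp: square_pairs_def Suc_le_eq nat_le_iff)
    moreover have "f = ?g (sgn a2, (nat \<bar>a0\<bar>, nat \<bar>a2\<bar>))"
      using * neg by (auto simp: mult_less_0_iff)
    moreover have "sgn a2 \<in> {-1, 1}" using * by (auto simp: sgn_if)
    ultimately show "f \<in> ?g ` ?T" by (intro image_eqI) auto
  next
    fix f assume "f \<in> ?g ` ?T"
    then obtain s a b where f: "f = [:s * int b, 0, - s * int a:]" "s \<in> {-1, 1}" "(a, b) \<in> square_pairs H"
      by auto
    then obtain c where c: "a * b = c\<^sup>2" and ab: "a > 0" "b > 0" "a \<le> H" "b \<le> H"
      by (auto simp: square_pairs_def is_nth_power_def)
    have "- (- s * int a * (s * int b)) = int (a * b)" using f(2) by auto
    also have "\<dots> = (int c)\<^sup>2" unfolding c by simp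
    finally have "\<exists>c. c\<^sup>2 = - (- s * int a * (s * int b))" by metis
    then have "\<not> irreducible (map_poly of_int f :: rat poly)"
      unfolding f(1) using f(2) ab by (subst reducible_pure_quadratic_iff) auto
    moreover have "f \<in> pure_quadratics H"
      unfolding pure_quadratics_def using f(1,2) ab
      by (intro CollectI exI[of _ "- s * int a"] exI[of _ "s * int b"]) auto
    ultimately show "f \<in> {f \<in> pure_quadratics H. \<not> irreducible (map_poly of_int f :: rat poly)}" by simp
  qed
  finally have "R2 H = card (?g ` ?T)" by (simp add: R2_def)
  also have "\<dots> = card ?T"
    by (rule card_image) (auto simp: inj_on_def square_pairs_def)
  also have "\<dots> = 2 * card (square_pairs H)" by (simp add: card_cartesian_product)
  finally show ?thesis .
qed

lemma zeta_2: "zeta 2 = pi\<^sup>2 / 6"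
proof -
  have "(\<lambda>n. 1 / real (Suc n) powr 2) sums (pi\<^sup>2 / 6)"
    using inverse_squares_sums by (simp add: add.commute)
  then show ?thesis unfolding zeta_def by (rule sums_unique[symmetric])
qed

subsection \<open>Asymptotics\<close>

theorem theorem6p3:
  shows "((\<lambda>H::nat. real (I2 H) / real H ^ 2) \<longlonglongrightarrow> 4) \<and>
         ((\<lambda>H::nat. real (R2 H) / (real H * ln (real H))) \<longlonglongrightarrow> 2 / zeta 2) \<and>
         2 / zeta 2 = 12 / pi ^ 2 \<and>
         ((\<lambda>H::nat. real (D2 H) / real H ^ 2) \<longlonglongrightarrow> 4)"
proof (intro conjI)
  have M: "(\<lambda>H. real (card (mixed_quadratics H)) / real H ^ 2) \<longlonglongrightarrow> 0"
  proof (rule Lim_null_comparison)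
    show "(\<lambda>H. 24 * (real (card (square_pairs (3 * H))) / real H ^ 2)) \<longlonglongrightarrow> 0"
      by (rule tendsto_mult_right_zero[OF card_square_pairs_div_square]) simp
    show "\<forall>\<^sub>F H in sequentially. norm (real (card (mixed_quadratics H)) / real H ^ 2)
        \<le> 24 * (real (card (square_pairs (3 * H))) / real H ^ 2)"
    proof (intro always_eventually allI)
      fix H
      have "real (card (mixed_quadratics H)) \<le> real (24 * card (square_pairs (3 * H)))"
        using mixed_quadratics_bound(2)[of H] by (simp only: of_nat_le_iff)
      then show "norm (real (card (mixed_quadratics H)) / real H ^ 2)
        \<le> 24 * (real (card (square_pairs (3 * H))) / real H ^ 2)"
        by (simp add: divide_right_mono)
    qed
  qed
  \<comment> \<open>At \<open>H = 0\<close> the equation fails, as the right side is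
    \<open>0 / 0 = 0\<close>.\<close>
  have "\<forall>\<^sub>F H in sequentially. 4 + real (card (mixed_quadratics H)) / real H ^ 2 = real (D2 H) / real H ^ 2"
    using eventually_gt_at_top[of 0] by eventually_elim (simp add: D2_eq add_divide_distrib)
  moreover have "(\<lambda>H. 4 + real (card (mixed_quadratics H)) / real H ^ 2) \<longlonglongrightarrow> 4 + 0"
    by (intro tendsto_intros M)
  ultimately show D: "(\<lambda>H. real (D2 H) / real H ^ 2) \<longlonglongrightarrow> 4"
    by (simp add: tendsto_cong)
  \<comment> \<open>The reducible polynomials are negligible on the scale \<open>H^2\<close>, so
    \<open>I2 = D2 - R2\<close> inherits the limit of \<open>D2\<close>.\<close>
  have "(\<lambda>H. 2 * (real (card (square_pairs (1 * H))) / real H ^ 2)) \<longlonglongrightarrow> 0"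
    by (rule tendsto_mult_right_zero[OF card_square_pairs_div_square]) simp
  then have R: "(\<lambda>H. real (R2 H) / real H ^ 2) \<longlonglongrightarrow> 0"
    by (simp add: R2_eq)
  have "I2 H = D2 H - R2 H" "R2 H \<le> D2 H" for H
    using I2_add_R2[of H] by linarith+
  with tendsto_diff[OF D R] show "(\<lambda>H. real (I2 H) / real H ^ 2) \<longlonglongrightarrow> 4"
    by (simp add: of_nat_diff diff_divide_distrib)
  have "(\<lambda>H. 2 * (real (card (square_pairs H)) / (real H * ln (real H)))) \<longlonglongrightarrow> 2 * (6 / pi\<^sup>2)"
    by (intro tendsto_intros card_square_pairs_asymp)
  then show "(\<lambda>H. real (R2 H) / (real H * ln (real H))) \<longlonglongrightarrow> 2 / zeta 2"
    by (simp add: R2_eq zeta_2)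
  show "2 / zeta 2 = 12 / pi ^ 2" by (simp add: zeta_2)
qed

end
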